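(* Let $G$ be a feebly compact paratopological group. The following conditions are equivalent: (1) $G$ is quasiregular; (2) $G$ is saturated; (3) $G$ is topologically periodic and Baire; (4) $G$ is left $\omega$-precompact and Baire; (5) $G$ is precompact; (6) $G$ is a topological group.
   Context: A paratopological group is a group with a topology such that the multiplication is continuous; it is a topological group if moreover inversion is continuous. No separation axioms are assumed. A space is feebly compact if each locally finite family of its open subsets is finite. A space $X$ is quasiregular if every nonempty open subset of $X$ contains the closure of some nonempty open subset of $X$. $G$ is saturated if for each nonempty open $U\subseteq G$ there is a nonempty open $V\subseteq G$ with $V^{-1}\subseteq U$. $G$ is topologically periodic if for each $x\in G$ and each neighborhood $U$ of the identity there is $n\ge 1$ with $x^n\in U$. $G$ is left $\omega$-precompact if for each neighborhood $U$ of the identity there is a countable $F\subseteq G$ with $FU=G$. $G$ is precompact if for each neighborhood $U$ of the identity there is a finite $F\subseteq G$ with $FU=G$. A space is Baire if every countable intersection of dense open subsets is dense. *)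

theory Defs
  imports "HOL-Algebra.Coset" "HOL-Analysis.Product_Topology"
begin

locale paratopological_group = group G for G :: "('a, 'b) monoid_scheme" (structure) +
  fixes T :: "'a topology"
  assumes topspace_eq_carrier: "topspace T = carrier G"
    and continuous_mult: "continuous_map (prod_topology T T) T (\<lambda>(x, y). x \<otimes> y)"

locale topological_group = paratopological_group +
  assumes continuous_inv: "continuous_map T T (\<lambda>x. inv x)"

definition neighbourhood_in :: "'a topology \<Rightarrow> 'a \<Rightarrow> 'a set \<Rightarrow> bool" where
  "neighbourhood_in X x U \<longleftrightarrow>
     U \<subseteq> topspace X \<and> (\<exists>V. openin X V \<and> x \<in> V \<and> V \<subseteq> U)"

definition feebly_compact_space :: "'a topology \<Rightarrow> bool" where
  "feebly_compact_space X \<longleftrightarrow>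
     (\<forall>\<U>. (\<forall>U\<in>\<U>. openin X U) \<and> locally_finite_in X \<U> \<longrightarrow> finite \<U>)"

definition quasiregular_space :: "'a topology \<Rightarrow> bool" where
  "quasiregular_space X \<longleftrightarrow>
     (\<forall>U. openin X U \<and> U \<noteq> {} \<longrightarrow>
        (\<exists>V. openin X V \<and> V \<noteq> {} \<and> X closure_of V \<subseteq> U))"

text \<open>The intersection is taken inside the space, so that the empty family yields the
  whole space and not the whole type.\<close>

definition baire_space :: "'a topology \<Rightarrow> bool" where
  "baire_space X \<longleftrightarrow>
     (\<forall>\<U>. countable \<U> \<and> (\<forall>U\<in>\<U>. openin X U \<and> X closure_of U = topspace X) \<longrightarrow>
        X closure_of (topspace X \<inter> \<Inter>\<U>) = topspace X)"

definition saturated :: "('a, 'b) monoid_scheme \<Rightarrow> 'a topology \<Rightarrow> bool" where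
  "saturated G T \<longleftrightarrow>
     (\<forall>U. openin T U \<and> U \<noteq> {} \<longrightarrow>
        (\<exists>V. openin T V \<and> V \<noteq> {} \<and> set_inv\<^bsub>G\<^esub> V \<subseteq> U))"

definition topologically_periodic :: "('a, 'b) monoid_scheme \<Rightarrow> 'a topology \<Rightarrow> bool" where
  "topologically_periodic G T \<longleftrightarrow>
     (\<forall>x\<in>carrier G. \<forall>U. neighbourhood_in T \<one>\<^bsub>G\<^esub> U \<longrightarrow>
        (\<exists>n::nat. n \<ge> 1 \<and> x [^]\<^bsub>G\<^esub> n \<in> U))"

definition left_omega_precompact :: "('a, 'b) monoid_scheme \<Rightarrow> 'a topology \<Rightarrow> bool" where
  "left_omega_precompact G T \<longleftrightarrow>
     (\<forall>U. neighbourhood_in T \<one>\<^bsub>G\<^esub> U \<longrightarrow>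
        (\<exists>F. F \<subseteq> carrier G \<and> countable F \<and> F <#>\<^bsub>G\<^esub> U = carrier G))"

definition precompact :: "('a, 'b) monoid_scheme \<Rightarrow> 'a topology \<Rightarrow> bool" where
  "precompact G T \<longleftrightarrow>
     (\<forall>U. neighbourhood_in T \<one>\<^bsub>G\<^esub> U \<longrightarrow>
        (\<exists>F. F \<subseteq> carrier G \<and> finite F \<and> F <#>\<^bsub>G\<^esub> U = carrier G))"

end

(* Everything is funnelled through saturation. Precompactness, or omega-precompactness together with
   Baire, makes the inverse of each neighbourhood of the identity somewhere dense up to translation,
   which gives saturation; with periodicity the same argument is applied to powers. Feebly compact
   topological groups have all the other properties by classical arguments. The core is that, if G is feebly compact and
   quasiregular or saturated, every neighbourhood U of the identity 1 admits a neighbourhood V with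
   inv V inside the closure of U: otherwise one builds a nested sequence of open sets without the
   required point of accumulation. In the quasiregular case this yields saturation. In the saturated
   case, apply it to W with W W inside U, take V inside W, and let V' be nonempty open with inv V'
   inside V. Then V' lies in the closure of W, hence contains some v in W, and inv v V' is a
   neighbourhood of 1 whose inverse inv V' v lies in W W. *)

theory Submission
  imports Defs
begin

section \<open>Feeble compactness and Baire category\<close>

text \<open>Without such a point \<open>range B\<close> would be locally finite, hence finite. Since
  \<open>B\<close> may repeat sets, this is not yet absurd: by pigeonhole some \<open>B k\<close>
  recurs infinitely often, and any of its points is an accumulation point after all.\<close>

lemma feebly_compact_accumulation:
  fixes B :: "nat \<Rightarrow> 'a set"
  assumes fc: "feebly_compact_space X"
    and B: "\<And>n. openin X (B n) \<and> B n \<noteq> {}"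
  shows "\<exists>y\<in>topspace X. \<forall>N. openin X N \<and> y \<in> N \<longrightarrow> (\<exists>\<^sub>\<infinity>n. N \<inter> B n \<noteq> {})"
proof (rule ccontr)
  assume "\<not> ?thesis"
  then have "\<exists>N. openin X N \<and> y \<in> N \<and> \<not> (\<exists>\<^sub>\<infinity>n. N \<inter> B n \<noteq> {})" if "y \<in> topspace X" for y
    using that by meson
  then have no: "\<exists>N. openin X N \<and> y \<in> N \<and> finite {n. N \<inter> B n \<noteq> {}}" if "y \<in> topspace X" for y
    using that by (simp add: INFM_iff_infinite)
  have "\<exists>V. openin X V \<and> y \<in> V \<and> finite {U \<in> range B. U \<inter> V \<noteq> {}}" if y: "y \<in> topspace X" for y
  proof -
    obtain N where N: "openin X N" "y \<in> N" "finite {n. N \<inter> B n \<noteq> {}}"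
      using no[OF y] by metis
    have "{U \<in> range B. U \<inter> N \<noteq> {}} \<subseteq> B ` {n. N \<inter> B n \<noteq> {}}"
      by blast
    then have "finite {U \<in> range B. U \<inter> N \<noteq> {}}"
      by (rule finite_surj[OF N(3)])
    then show ?thesis
      using N by metis
  qed
  moreover have "\<Union>(range B) \<subseteq> topspace X"
    using B openin_subset by (metis UN_least)
  ultimately have "locally_finite_in X (range B)"
    unfolding locally_finite_in_def by simp
  then have "finite (range B)"
    using fc B unfolding feebly_compact_space_def by (metis imageE)
  then obtain k where k: "infinite {n. B n = B k}"
    using pigeonhole_infinite[of UNIV B] by auto
  obtain y where y: "y \<in> B k"
    using B by blast
  then obtain N where N: "y \<in> N" "finite {n. N \<inter> B n \<noteq> {}}"
    using no B openin_subset by (metis subsetD)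
  have "{n. B n = B k} \<subseteq> {n. N \<inter> B n \<noteq> {}}"
    using y N(1) by blast
  then show False
    using k N(2) finite_subset by blast
qed

text \<open>Some \<open>B m\<close> with \<open>m > n\<close> is met, and it lies in
  \<open>D (Suc n)\<close>. The family \<open>\<N> y\<close> is abstract because it stands both for
  the open sets around \<open>y\<close> and for translates \<open>y <# N\<close>, which need not be
  open in \<open>T\<close>.\<close>

lemma accumulation_nested:
  fixes D B :: "nat \<Rightarrow> 'a set" and \<N> :: "'a \<Rightarrow> 'a set set"
  assumes acc: "\<forall>N\<in>\<N> y. \<exists>\<^sub>\<infinity>n. N \<inter> B n \<noteq> {}"
    and sub: "\<And>n. B n \<subseteq> D n" "\<And>n. D (Suc n) \<subseteq> D n"
    and shrink: "\<And>n. \<forall>N\<in>\<N> y. N \<inter> D (Suc n) \<noteq> {} \<Longrightarrow> y \<in> D n"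
  shows "y \<in> D n"
proof (rule shrink, intro ballI)
  fix N assume "N \<in> \<N> y"
  then obtain m where m: "m > n" "N \<inter> B m \<noteq> {}"
    using acc unfolding INFM_nat by blast
  have "D m \<subseteq> D (Suc n)"
    using lift_Suc_antimono_le[of D "Suc n" m] sub(2) m(1) by simp
  then show "N \<inter> D (Suc n) \<noteq> {}"
    using m(2) sub(1) by blast
qed

text \<open>The usual Baire descent, with a point of accumulation in place of compactness: closures
  of the nested sets are pushed into the dense open sets, and the point lies in all these
  closures.\<close>

lemma feebly_compact_quasiregular_imp_baire:
  assumes fc: "feebly_compact_space X" and qr: "quasiregular_space X"
  shows "baire_space X"
  unfolding baire_space_def
proof (intro allI impI)
  fix \<U> assume \<U>: "countable \<U> \<and> (\<forall>U\<in>\<U>. openin X U \<and> X closure_of U = topspace X)"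
  show "X closure_of (topspace X \<inter> \<Inter>\<U>) = topspace X"
  proof (cases "\<U> = {}")
    case False
    \<comment> \<open>The family is nonempty here, so \<open>from_nat_into\<close> enumerates
      exactly \<open>\<U>\<close>, with repetitions if it is finite.\<close>
    define E where "E = from_nat_into \<U>"
    have E: "range E = \<U>"
      using \<U> False unfolding E_def by (simp add: range_from_nat_into)
    have "(topspace X \<inter> \<Inter>\<U>) \<inter> C \<noteq> {}" if C: "openin X C" "C \<noteq> {}" for C
    proof -
      have "\<exists>D. \<forall>n. (openin X (D n) \<and> D n \<noteq> {} \<and> D n \<subseteq> C) \<and> X closure_of (D (Suc n)) \<subseteq> D n \<inter> E n"
      proof (rule dependent_nat_choice)
        show "\<exists>D. openin X D \<and> D \<noteq> {} \<and> D \<subseteq> C"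
          using C by blast
        fix D n assume D: "openin X D \<and> D \<noteq> {} \<and> D \<subseteq> C"
        have "openin X (E n)" "X closure_of E n = topspace X"
          using \<U> E by blast+
        then have "openin X (D \<inter> E n)" "D \<inter> E n \<noteq> {}"
          using D dense_intersects_open[of X "E n"] by blast+
        then obtain V where V: "openin X V" "V \<noteq> {}" "X closure_of V \<subseteq> D \<inter> E n"
          using qr unfolding quasiregular_space_def by metis
        moreover have "V \<subseteq> X closure_of V"
          using V(1) by (simp add: closure_of_subset openin_subset)
        ultimately show "\<exists>V. (openin X V \<and> V \<noteq> {} \<and> V \<subseteq> C) \<and> X closure_of V \<subseteq> D \<inter> E n"
          using D by blast
      qed
      then obtain D where D: "\<And>n. openin X (D n) \<and> D n \<noteq> {}" "\<And>n. D n \<subseteq> C"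
        "\<And>n. X closure_of (D (Suc n)) \<subseteq> D n \<inter> E n"
        by blast
      obtain y where y: "y \<in> topspace X" "\<forall>N. openin X N \<and> y \<in> N \<longrightarrow> (\<exists>\<^sub>\<infinity>n. N \<inter> D n \<noteq> {})"
        using feebly_compact_accumulation[of X D, OF fc D(1)] by blast
      have cl: "y \<in> X closure_of S" if "\<forall>N\<in>{N. openin X N \<and> y \<in> N}. N \<inter> S \<noteq> {}" for S
        using that y(1) unfolding in_closure_of by blast
      have sub: "D (Suc n) \<subseteq> D n" for n
        using D(1)[of "Suc n"] D(3)[of n] closure_of_subset[of "D (Suc n)" X] openin_subset by blast
      have yD: "y \<in> D n" for n
      proof (rule accumulation_nested[where \<N> = "\<lambda>y. {N. openin X N \<and> y \<in> N}" and B = D])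
        show "y \<in> D n" if "\<forall>N\<in>{N. openin X N \<and> y \<in> N}. N \<inter> D (Suc n) \<noteq> {}" for n
          using cl[OF that] D(3)[of n] by blast
      qed (use y sub in auto)
      have "y \<in> E n" for n
        using yD[of "Suc n"] D(1)[of "Suc n"] D(3)[of n] closure_of_subset[of "D (Suc n)" X] openin_subset
        by blast
      then show ?thesis
        using y(1) yD D(2) E by blast
    qed
    then show ?thesis
      unfolding dense_intersects_open by blast
  qed simp
qed

text \<open>If all closures had empty interior, their complements would be countably many dense open
  sets with empty intersection.\<close>

lemma baire_somewhere_dense:
  assumes "baire_space X" "countable I" "topspace X \<noteq> {}" "topspace X \<subseteq> (\<Union>i\<in>I. A i)"
  shows "\<exists>i\<in>I. X interior_of (X closure_of A i) \<noteq> {}"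
proof (rule ccontr)
  assume "\<not> ?thesis"
  then have "X closure_of (topspace X - X closure_of A i) = topspace X" if "i \<in> I" for i
    using that by (simp add: closure_of_complement)
  moreover have "openin X (topspace X - X closure_of A i)" for i
    by (simp add: openin_diff)
  ultimately have "X closure_of (topspace X \<inter> \<Inter>((\<lambda>i. topspace X - X closure_of A i) ` I)) = topspace X"
    using assms(1,2) unfolding baire_space_def by (metis (no_types, lifting) countable_image imageE)
  moreover have "topspace X \<inter> \<Inter>((\<lambda>i. topspace X - X closure_of A i) ` I) = {}"
    using assms(4) closure_of_subset_Int[of X] by blast
  ultimately show False
    using assms(3) by (metis closure_of_empty)
qed

text \<open>Closed sets with empty interior are stable under finite unions in every space. This
  finite counterpart of the Baire argument serves the precompact case.\<close>

lemma finite_Union_somewhere_dense: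
  assumes "finite I" "topspace X \<noteq> {}" "topspace X \<subseteq> (\<Union>i\<in>I. A i)"
  shows "\<exists>i\<in>I. X interior_of (X closure_of A i) \<noteq> {}"
proof (rule ccontr)
  assume no: "\<not> ?thesis"
  have "X interior_of (\<Union>i\<in>J. X closure_of A i) = {}" if "finite J" "J \<subseteq> I" for J
    using that
  proof induction
    case (insert i J)
    then show ?case
      using no interior_of_closedin_union_empty_interior_of[of X "X closure_of A i" "\<Union>i\<in>J. X closure_of A i"]
      by auto
  qed simp
  from this[OF assms(1)] have "X interior_of (\<Union>i\<in>I. X closure_of A i) = {}"
    by simp
  moreover have "topspace X \<subseteq> (\<Union>i\<in>I. X closure_of A i)"
    using assms(3) closure_of_subset_Int[of X] by blast
  ultimately show False
    using assms(2) interior_of_maximal[of "topspace X" "\<Union>i\<in>I. X closure_of A i" X] by auto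
qed

section \<open>Translations, neighbourhoods of the identity and closures\<close>

lemma (in group) inv_mult_cancel_left [simp]:
  assumes "a \<in> carrier G" "b \<in> carrier G"
  shows "a \<otimes> (inv a \<otimes> b) = b" "inv a \<otimes> (a \<otimes> b) = b"
  using assms by (simp_all flip: m_assoc)

context paratopological_group
begin

lemma openin_carrier: "openin T U \<Longrightarrow> U \<subseteq> carrier G"
  using openin_subset topspace_eq_carrier by blast

lemma continuous_map_mult:
  assumes "continuous_map X T f" "continuous_map X T g"
  shows "continuous_map X T (\<lambda>x. f x \<otimes> g x)"
  using continuous_map_compose[OF continuous_map_pairedI[OF assms] continuous_mult]
  by (simp add: o_def)

lemma continuous_map_nat_pow: "continuous_map T T (\<lambda>x. x [^] (n::nat))"
proof (induction n)
  case 0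
  then show ?case
    using topspace_eq_carrier by simp
next
  case (Suc n)
  then show ?case
    using continuous_map_mult[OF Suc continuous_map_id[unfolded id_def]] by simp
qed

text \<open>Translates are written as preimages throughout: their openness is then continuity of
  multiplication alone.\<close>

lemma openin_mult_left:
  assumes "openin T U" "a \<in> carrier G"
  shows "openin T {x \<in> carrier G. a \<otimes> x \<in> U}"
  using openin_continuous_map_preimage[OF continuous_map_mult[of T "\<lambda>x. a" "\<lambda>x. x"] assms(1)] assms(2)
    topspace_eq_carrier by simp

lemma openin_mult_right:
  assumes "openin T U" "a \<in> carrier G"
  shows "openin T {x \<in> carrier G. x \<otimes> a \<in> U}"
  using openin_continuous_map_preimage[OF continuous_map_mult[of T "\<lambda>x. x" "\<lambda>x. a"] assms(1)] assms(2)
    topspace_eq_carrier by simp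

definition unit_nbhd :: "'a set \<Rightarrow> bool" where
  "unit_nbhd U \<longleftrightarrow> openin T U \<and> \<one> \<in> U"

lemma unit_nbhd_carrier [simp]: "unit_nbhd U \<Longrightarrow> x \<in> U \<Longrightarrow> x \<in> carrier G"
  unfolding unit_nbhd_def using openin_carrier by blast

lemma unit_nbhd_Int: "unit_nbhd U \<Longrightarrow> unit_nbhd V \<Longrightarrow> unit_nbhd (U \<inter> V)"
  unfolding unit_nbhd_def by blast

lemma unit_nbhd_left:
  assumes "openin T U" "x \<in> U"
  shows "unit_nbhd {w \<in> carrier G. x \<otimes> w \<in> U}"
  using assms openin_carrier[OF assms(1)] unfolding unit_nbhd_def by (auto intro: openin_mult_left)

lemma unit_nbhd_right:
  assumes "openin T U" "x \<in> U"
  shows "unit_nbhd {w \<in> carrier G. w \<otimes> x \<in> U}"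
  using assms openin_carrier[OF assms(1)] unfolding unit_nbhd_def by (auto intro: openin_mult_right)

lemma unit_nbhd_square:
  assumes "unit_nbhd U"
  shows "\<exists>V. unit_nbhd V \<and> V \<subseteq> U \<and> (\<forall>a\<in>V. \<forall>b\<in>V. a \<otimes> b \<in> U)"
proof -
  define S where "S = {p \<in> topspace (prod_topology T T). (case p of (x, y) \<Rightarrow> x \<otimes> y) \<in> U}"
  have "openin (prod_topology T T) S"
    using openin_continuous_map_preimage[OF continuous_mult] assms unfolding unit_nbhd_def S_def by simp
  moreover have "(\<one>, \<one>) \<in> S"
    using assms topspace_eq_carrier unfolding unit_nbhd_def S_def by simp
  ultimately obtain A B where AB: "openin T A" "openin T B" "\<one> \<in> A" "\<one> \<in> B" "A \<times> B \<subseteq> S"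
    by (metis openin_prod_topology_alt)
  have sq: "a \<otimes> b \<in> U" if "a \<in> A \<inter> B" "b \<in> A \<inter> B" for a b
  proof -
    have "(a, b) \<in> S"
      using AB(5) that by auto
    then show ?thesis
      unfolding S_def by simp
  qed
  have "unit_nbhd (A \<inter> B)"
    using AB unfolding unit_nbhd_def by blast
  moreover have "A \<inter> B \<subseteq> U"
    using sq[of _ \<one>] AB openin_carrier[of A] by force
  ultimately show ?thesis
    using sq by (intro exI[of _ "A \<inter> B"]) simp
qed

lemma closure_of_meets:
  assumes "x \<in> T closure_of A" "openin T N" "x \<in> N"
  obtains z where "z \<in> A" "z \<in> N"
  using assms unfolding in_closure_of by metis

text \<open>The translates \<open>x <# W\<close> form a neighbourhood base at \<open>x\<close>,
  since left translations are homeomorphisms.\<close>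

lemma in_closure_left:
  "x \<in> T closure_of A \<longleftrightarrow> x \<in> carrier G \<and> (\<forall>W. unit_nbhd W \<longrightarrow> (\<exists>w\<in>W. x \<otimes> w \<in> A))"
proof (intro iffI conjI allI impI)
  show "x \<in> carrier G" if "x \<in> T closure_of A"
    using that in_closure_of topspace_eq_carrier by metis
  fix W assume x: "x \<in> T closure_of A" and W: "unit_nbhd W"
  then have xc: "x \<in> carrier G"
    using in_closure_of topspace_eq_carrier by metis
  then have "openin T {z \<in> carrier G. inv x \<otimes> z \<in> W}" "x \<in> {z \<in> carrier G. inv x \<otimes> z \<in> W}"
    using W openin_mult_left[of W "inv x"] unfolding unit_nbhd_def by auto
  then obtain z where "z \<in> A" "z \<in> carrier G" "inv x \<otimes> z \<in> W"
    using closure_of_meets[OF x] by (metis (no_types, lifting) mem_Collect_eq)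
  then show "\<exists>w\<in>W. x \<otimes> w \<in> A"
    using xc by (intro bexI[of _ "inv x \<otimes> z"]) auto
next
  assume x: "x \<in> carrier G \<and> (\<forall>W. unit_nbhd W \<longrightarrow> (\<exists>w\<in>W. x \<otimes> w \<in> A))"
  have "\<exists>y. y \<in> A \<and> y \<in> N" if N: "x \<in> N" "openin T N" for N
  proof -
    obtain w where "w \<in> {w \<in> carrier G. x \<otimes> w \<in> N}" "x \<otimes> w \<in> A"
      using x unit_nbhd_left[OF N(2,1)] by metis
    then show ?thesis
      by auto
  qed
  then show "x \<in> T closure_of A"
    using x topspace_eq_carrier by (simp add: in_closure_of)
qed

lemma in_closure_right:
  assumes "x \<in> T closure_of A" "unit_nbhd W"
  shows "\<exists>w\<in>W. w \<otimes> x \<in> A"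
proof -
  have xc: "x \<in> carrier G"
    using assms in_closure_left by blast
  then have "openin T {z \<in> carrier G. z \<otimes> inv x \<in> W}" "x \<in> {z \<in> carrier G. z \<otimes> inv x \<in> W}"
    using assms(2) openin_mult_right[of W "inv x"] unfolding unit_nbhd_def by auto
  then obtain z where "z \<in> A" "z \<in> carrier G" "z \<otimes> inv x \<in> W"
    using closure_of_meets[OF assms(1)] by (metis (no_types, lifting) mem_Collect_eq)
  then show "\<exists>w\<in>W. w \<otimes> x \<in> A"
    using xc by (intro bexI[of _ "z \<otimes> inv x"]) (auto simp: m_assoc)
qed

section \<open>Saturation and inverses in closures\<close>

text \<open>Translations can be absorbed: a point \<open>u\<close> of the target moves it to the
  identity, and \<open>P\<close> is shifted on the right by the inverse of
  \<open>u \<otimes> g\<close>. So neighbourhoods of the identity suffice, up to a left factor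
  \<open>g\<close>.\<close>

lemma saturatedI:
  assumes "\<And>W. unit_nbhd W \<Longrightarrow>
    \<exists>P g. openin T P \<and> P \<noteq> {} \<and> g \<in> carrier G \<and> (\<forall>x\<in>P. g \<otimes> inv x \<in> W)"
  shows "saturated G T"
  unfolding saturated_def
proof (intro allI impI)
  fix U assume U: "openin T U \<and> U \<noteq> {}"
  then obtain u where u: "u \<in> U" "u \<in> carrier G"
    using openin_carrier by blast
  obtain P g where P: "openin T P" "P \<noteq> {}" "g \<in> carrier G" "\<forall>x\<in>P. u \<otimes> (g \<otimes> inv x) \<in> U"
    using assms[OF unit_nbhd_left[of U u]] U u by blast
  have inv_eq: "inv v = u \<otimes> (g \<otimes> inv (v \<otimes> (u \<otimes> g)))" if "v \<in> carrier G" for v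
    using that u(2) P(3) by (simp add: inv_mult_group m_assoc)
  define V where "V = {v \<in> carrier G. v \<otimes> (u \<otimes> g) \<in> P}"
  obtain p where p: "p \<in> P" "p \<in> carrier G"
    using P(1,2) openin_carrier by blast
  have "openin T V"
    unfolding V_def using P u by (intro openin_mult_right) auto
  moreover have "p \<otimes> inv (u \<otimes> g) \<in> V"
    using p P u by (simp add: V_def m_assoc)
  moreover have "set_inv V \<subseteq> U"
    using P(4) inv_eq unfolding SET_INV_def V_def by auto
  ultimately show "\<exists>V. openin T V \<and> V \<noteq> {} \<and> set_inv V \<subseteq> U"
    by (intro exI[of _ V]) auto
qed

lemma saturatedD:
  assumes "saturated G T" "openin T U" "U \<noteq> {}"
  shows "\<exists>V. openin T V \<and> V \<noteq> {} \<and> (\<forall>v\<in>V. inv v \<in> U)"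
proof -
  obtain V where V: "openin T V" "V \<noteq> {}" "set_inv V \<subseteq> U"
    using assms unfolding saturated_def by metis
  then show ?thesis
    unfolding SET_INV_def by (intro exI[of _ V]) (simp add: UN_subset_iff)
qed

text \<open>If no such \<open>C\<close> existed, one could choose nested \<open>D n\<close> and open \<open>B n \<subseteq> D n\<close> missing
  \<open>D (Suc n) <#> A\<close>; a point of accumulation \<open>y\<close> of \<open>B\<close> lies in every \<open>D n\<close>, while \<open>y <# A\<close>
  meets some \<open>B n\<close>.\<close>

lemma exists_dense_translates:
  assumes acc: "\<And>B::nat \<Rightarrow> 'a set. (\<And>n. openin T (B n) \<and> B n \<noteq> {}) \<Longrightarrow>
      \<exists>y\<in>carrier G. \<forall>N\<in>\<N>. \<exists>\<^sub>\<infinity>n. (y <# N) \<inter> B n \<noteq> {}"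
    and shrink: "\<And>C. openin T C \<Longrightarrow> C \<noteq> {} \<Longrightarrow> \<exists>C'. openin T C' \<and> C' \<noteq> {} \<and> C' \<subseteq> C \<and>
      (\<forall>y\<in>carrier G. (\<forall>N\<in>\<N>. (y <# N) \<inter> C' \<noteq> {}) \<longrightarrow> y \<in> C)"
    and A: "A \<in> \<N>"
  shows "\<exists>C. openin T C \<and> C \<noteq> {} \<and>
    (\<forall>C'. openin T C' \<and> C' \<noteq> {} \<and> C' \<subseteq> C \<longrightarrow> C \<subseteq> T closure_of (C' <#> A))"
proof (rule ccontr)
  assume "\<not> ?thesis"
  then have no: "\<exists>C'. openin T C' \<and> C' \<noteq> {} \<and> C' \<subseteq> C \<and> \<not> C \<subseteq> T closure_of (C' <#> A)"
    if "openin T C" "C \<noteq> {}" for C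
    using that by meson
  \<comment> \<open>\<open>C'\<close> is the next set of the descent, and \<open>C\<close> catches
    every point whose translates all meet \<open>C'\<close>; \<open>B\<close> is an open part of
    \<open>C\<close> missed by the products \<open>C' <#> A\<close>.\<close>
  define Q where "Q C C' B \<longleftrightarrow> C' \<subseteq> C \<and>
      (\<forall>y\<in>carrier G. (\<forall>N\<in>\<N>. (y <# N) \<inter> C' \<noteq> {}) \<longrightarrow> y \<in> C) \<and>
      openin T B \<and> B \<noteq> {} \<and> B \<subseteq> C \<and> B \<inter> (C' <#> A) = {}" for C C' B
  have "\<exists>D. \<forall>n::nat. (openin T (D n) \<and> D n \<noteq> {}) \<and> (\<exists>B. Q (D n) (D (Suc n)) B)"
  proof (rule dependent_nat_choice)
    show "\<exists>C. openin T C \<and> C \<noteq> {}"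
      using topspace_eq_carrier one_closed openin_topspace[of T] by (metis empty_iff)
    fix C and n :: nat assume C: "openin T C \<and> C \<noteq> {}"
    then obtain C' where C': "openin T C'" "C' \<noteq> {}" "C' \<subseteq> C" "\<not> C \<subseteq> T closure_of (C' <#> A)"
      using no by metis
    \<comment> \<open>A second shrinking, inside the set \<open>C'\<close> that violates density,
      secures the catching property; the smaller \<open>C''\<close> still misses \<open>B\<close>
      with its products.\<close>
    obtain C'' where C'': "openin T C''" "C'' \<noteq> {}" "C'' \<subseteq> C'"
      "\<forall>y\<in>carrier G. (\<forall>N\<in>\<N>. (y <# N) \<inter> C'' \<noteq> {}) \<longrightarrow> y \<in> C'"
      using shrink[OF C'(1,2)] by metis
    define B where "B = C - T closure_of (C' <#> A)"
    have "B \<inter> (T closure_of (C' <#> A)) = {}"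
      unfolding B_def by blast
    then have "B \<inter> (C' <#> A) = {}"
      using closure_of_subset_Int[of T "C' <#> A"] C openin_subset[of T C] unfolding B_def by blast
    moreover have "C'' <#> A \<subseteq> C' <#> A"
      using C''(3) by (simp add: mono_set_mult)
    moreover have "openin T B"
      unfolding B_def using C by (simp add: openin_diff)
    ultimately have "Q C C'' B"
      unfolding Q_def using C'(3,4) C''(3,4) B_def by blast
    then show "\<exists>C''. (openin T C'' \<and> C'' \<noteq> {}) \<and> (\<exists>B. Q C C'' B)"
      using C'' by blast
  qed
  then obtain D where D: "\<And>n::nat. openin T (D n) \<and> D n \<noteq> {}" and "\<forall>n. \<exists>B. Q (D n) (D (Suc n)) B"
    by blast
  then obtain B where Q: "\<And>n. Q (D n) (D (Suc n)) (B n)"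
    by metis
  then obtain y where y: "y \<in> carrier G" "\<forall>N\<in>\<N>. \<exists>\<^sub>\<infinity>n. (y <# N) \<inter> B n \<noteq> {}"
    using acc[of B] unfolding Q_def by blast
  have yD: "y \<in> D n" for n
  proof (rule accumulation_nested[where \<N> = "\<lambda>y. (\<lambda>N. y <# N) ` \<N>" and B = B])
    show "y \<in> D n" if "\<forall>N\<in>(\<lambda>N. y <# N) ` \<N>. N \<inter> D (Suc n) \<noteq> {}" for n
      using Q[of n] that y(1) unfolding Q_def by blast
  qed (use y Q in \<open>auto simp: Q_def\<close>)
  obtain n where n: "(y <# A) \<inter> B n \<noteq> {}"
    using y(2) A frequently_ex by blast
  have "y <# A \<subseteq> D (Suc n) <#> A"
    using yD unfolding l_coset_def set_mult_def by blast
  then show False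
    using n Q[of n] unfolding Q_def by blast
qed

text \<open>Take \<open>C\<close> from \<open>exists_dense_translates\<close> with
  \<open>A = W\<close>, and \<open>c\<close> in \<open>C\<close>. If \<open>c \<otimes> v\<close> is
  in \<open>C\<close>, then \<open>c\<close> is in the closure of the products of points of
  \<open>C\<close> near \<open>c \<otimes> v\<close> with \<open>W\<close>; cancelling
  \<open>c \<otimes> v\<close> puts \<open>inv v\<close> in the closure of
  \<open>W <#> W\<close>.\<close>

lemma quasiregular_inv_in_closure:
  assumes fc: "feebly_compact_space T" and qr: "quasiregular_space T" and U: "unit_nbhd U"
  obtains V where "unit_nbhd V" "\<And>v. v \<in> V \<Longrightarrow> inv v \<in> T closure_of U"
proof -
  obtain W where W: "unit_nbhd W" "\<And>a b. a \<in> W \<Longrightarrow> b \<in> W \<Longrightarrow> a \<otimes> b \<in> U"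
    using unit_nbhd_square[OF U] by metis
  have meet: "(y <# N) \<inter> S \<noteq> {} \<longleftrightarrow> (\<exists>w\<in>N. y \<otimes> w \<in> S)" for y N S
    unfolding l_coset_def by blast
  have "\<exists>C. openin T C \<and> C \<noteq> {} \<and>
    (\<forall>C'. openin T C' \<and> C' \<noteq> {} \<and> C' \<subseteq> C \<longrightarrow> C \<subseteq> T closure_of (C' <#> W))"
  \<comment> \<open>For translates of unit neighbourhoods, meeting all of them means lying in the
    closure, so the shrinking condition is quasiregularity.\<close>
  proof (rule exists_dense_translates[where \<N> = "Collect unit_nbhd"])
    fix B :: "nat \<Rightarrow> 'a set" assume "\<And>n. openin T (B n) \<and> B n \<noteq> {}"
    then obtain y where y: "y \<in> carrier G"
      "\<And>N. openin T N \<and> y \<in> N \<Longrightarrow> \<exists>\<^sub>\<infinity>n. N \<inter> B n \<noteq> {}"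
      using feebly_compact_accumulation[OF fc] topspace_eq_carrier by metis
    have "\<exists>\<^sub>\<infinity>n. (y <# N) \<inter> B n \<noteq> {}" if "unit_nbhd N" for N
    proof -
      let ?N = "{z \<in> carrier G. inv y \<otimes> z \<in> N}"
      have "openin T ?N \<and> y \<in> ?N"
        using that y(1) openin_mult_left[of N "inv y"] unfolding unit_nbhd_def by auto
      then have "\<exists>\<^sub>\<infinity>n. ?N \<inter> B n \<noteq> {}"
        by (rule y(2))
      then show ?thesis
      proof (rule INFM_mono)
        fix n assume "?N \<inter> B n \<noteq> {}"
        then obtain z where z: "z \<in> carrier G" "inv y \<otimes> z \<in> N" "z \<in> B n"
          by blast
        moreover have "y \<otimes> (inv y \<otimes> z) = z"
          using z(1) y(1) by simp
        ultimately show "(y <# N) \<inter> B n \<noteq> {}"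
          unfolding meet by metis
      qed
    qed
    then show "\<exists>y\<in>carrier G. \<forall>N\<in>Collect unit_nbhd. \<exists>\<^sub>\<infinity>n. (y <# N) \<inter> B n \<noteq> {}"
      using y(1) by blast
  next
    fix C assume "openin T C" "C \<noteq> {}"
    then obtain C' where C': "openin T C'" "C' \<noteq> {}" "T closure_of C' \<subseteq> C"
      using qr unfolding quasiregular_space_def by metis
    moreover have "C' \<subseteq> C"
      using C' closure_of_subset openin_subset by (metis subset_trans)
    moreover have "y \<in> C" if "y \<in> carrier G" "\<forall>N\<in>Collect unit_nbhd. (y <# N) \<inter> C' \<noteq> {}" for y
      using that C'(3) in_closure_left[of y C'] unfolding meet by blast
    ultimately show "\<exists>C'. openin T C' \<and> C' \<noteq> {} \<and> C' \<subseteq> C \<and>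
      (\<forall>y\<in>carrier G. (\<forall>N\<in>Collect unit_nbhd. (y <# N) \<inter> C' \<noteq> {}) \<longrightarrow> y \<in> C)"
      by blast
  qed (use W in simp)
  then obtain C c where C: "openin T C" "c \<in> C"
    "\<And>C'. openin T C' \<Longrightarrow> C' \<noteq> {} \<Longrightarrow> C' \<subseteq> C \<Longrightarrow> C \<subseteq> T closure_of (C' <#> W)"
    by (metis ex_in_conv)
  have inC: "inv v \<in> T closure_of U" if v: "v \<in> carrier G" "c \<otimes> v \<in> C" for v
  proof -
    let ?x = "c \<otimes> v"
    \<comment> \<open>Restricting \<open>C\<close> to the translate \<open>?x <# W\<close> forces
      the first factor \<open>z\<close> below to be \<open>?x\<close> times an element of
      \<open>W\<close>.\<close>
    let ?C = "{z \<in> carrier G. inv ?x \<otimes> z \<in> W} \<inter> C"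
    have c: "c \<in> carrier G" "?x \<in> carrier G"
      using C openin_carrier v by blast+
    have "openin T ?C" "?x \<in> ?C"
      using v c W(1) C(1) openin_mult_left[of W "inv ?x"] unfolding unit_nbhd_def by auto
    then have cl: "c \<in> T closure_of (?C <#> W)"
      using C(2,3) by blast
    have "\<exists>n\<in>N. inv v \<otimes> n \<in> U" if N: "unit_nbhd N" for N
    proof -
      obtain n where n: "n \<in> N" "c \<otimes> n \<in> ?C <#> W"
        using cl N in_closure_left by blast
      then obtain z w where z: "z \<in> carrier G" "inv ?x \<otimes> z \<in> W" "w \<in> W" "c \<otimes> n = z \<otimes> w"
        unfolding set_mult_def by blast
      have nc: "n \<in> carrier G" "w \<in> carrier G"
        using n N W z by auto
      have "inv v \<otimes> n = inv ?x \<otimes> (c \<otimes> n)"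
        using nc c v by (simp add: inv_mult_group m_assoc)
      also have "\<dots> = (inv ?x \<otimes> z) \<otimes> w"
        using z nc c(2) by (simp add: m_assoc)
      also have "\<dots> \<in> U"
        using W(2) z by blast
      finally show ?thesis
        using n by blast
    qed
    then show ?thesis
      using v(1) unfolding in_closure_left by simp
  qed
  show ?thesis
    by (rule that[OF unit_nbhd_left[OF C(1,2)]]) (simp add: inC)
qed

text \<open>For saturated \<open>G\<close> the argument is run with the neighbourhoods of the inverse topology, in
  which every sequence of nonempty open subsets of \<open>T\<close> still accumulates.\<close>

lemma saturated_inv_in_closure:
  assumes fc: "feebly_compact_space T" and sat: "saturated G T" and U: "unit_nbhd U"
  obtains V where "unit_nbhd V" "\<And>v. v \<in> V \<Longrightarrow> inv v \<in> T closure_of U"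
proof -
  obtain W where W: "unit_nbhd W" "\<And>a b. a \<in> W \<Longrightarrow> b \<in> W \<Longrightarrow> a \<otimes> b \<in> U"
    using unit_nbhd_square[OF U] by metis
  have meet: "(y <# set_inv N) \<inter> S \<noteq> {} \<longleftrightarrow> (\<exists>w\<in>N. y \<otimes> inv w \<in> S)" for y N S
    unfolding l_coset_def SET_INV_def by blast
  have "\<exists>C. openin T C \<and> C \<noteq> {} \<and>
    (\<forall>C'. openin T C' \<and> C' \<noteq> {} \<and> C' \<subseteq> C \<longrightarrow> C \<subseteq> T closure_of (C' <#> set_inv W))"
  proof (rule exists_dense_translates[where \<N> = "(\<lambda>N. set_inv N) ` Collect unit_nbhd"])
    fix B :: "nat \<Rightarrow> 'a set" assume "\<And>n. openin T (B n) \<and> B n \<noteq> {}"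
    \<comment> \<open>Saturation replaces each \<open>B n\<close> by an open set whose inverse lies
      in it. A point of accumulation \<open>y\<close> of these sets, once inverted, is one for
      \<open>B\<close> with respect to inverse neighbourhoods.\<close>
    then have "\<forall>n. \<exists>V. openin T V \<and> V \<noteq> {} \<and> (\<forall>v\<in>V. inv v \<in> B n)"
      using saturatedD[OF sat] by simp
    then obtain V where V: "\<And>n. openin T (V n) \<and> V n \<noteq> {}" "\<And>n. \<forall>v\<in>V n. inv v \<in> B n"
      by metis
    obtain y where y: "y \<in> carrier G"
      "\<And>N. openin T N \<and> y \<in> N \<Longrightarrow> \<exists>\<^sub>\<infinity>n. N \<inter> V n \<noteq> {}"
      using feebly_compact_accumulation[of T V, OF fc V(1)] topspace_eq_carrier by metis
    have "\<exists>\<^sub>\<infinity>n. (inv y <# set_inv N) \<inter> B n \<noteq> {}" if "unit_nbhd N" for N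
    proof -
      let ?N = "{z \<in> carrier G. z \<otimes> inv y \<in> N}"
      have "openin T ?N \<and> y \<in> ?N"
        using that y(1) openin_mult_right[of N "inv y"] unfolding unit_nbhd_def by auto
      then have "\<exists>\<^sub>\<infinity>n. ?N \<inter> V n \<noteq> {}"
        by (rule y(2))
      then show ?thesis
      proof (rule INFM_mono)
        fix n assume "?N \<inter> V n \<noteq> {}"
        then obtain z where z: "z \<in> carrier G" "z \<otimes> inv y \<in> N" "inv z \<in> B n"
          using V(2) by blast
        moreover have "inv y \<otimes> inv (z \<otimes> inv y) = inv z"
          using z(1) y(1) by (simp add: inv_mult_group)
        ultimately show "(inv y <# set_inv N) \<inter> B n \<noteq> {}"
          unfolding meet by metis
      qed
    qed
    then show "\<exists>y\<in>carrier G. \<forall>N\<in>(\<lambda>N. set_inv N) ` Collect unit_nbhd. \<exists>\<^sub>\<infinity>n. (y <# N) \<inter> B n \<noteq> {}"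
      using y(1) by (intro bexI[of _ "inv y"]) auto
  next
    fix C assume C: "openin T C" "C \<noteq> {}"
    then obtain c where c: "c \<in> C" "c \<in> carrier G"
      using openin_carrier by blast
    \<comment> \<open>\<open>Z\<close> satisfies \<open>c <# (Z <#> Z) \<subseteq> C\<close>: if
      \<open>y \<otimes> inv z\<close> lies in \<open>C' = c <# Z\<close> for some \<open>z\<close>
      in \<open>Z\<close>, multiplying by \<open>z\<close> puts \<open>y\<close> in
      \<open>C\<close>.\<close>
    obtain Z where Z: "unit_nbhd Z"
      "\<And>a b. a \<in> Z \<Longrightarrow> b \<in> Z \<Longrightarrow> a \<otimes> b \<in> {w \<in> carrier G. c \<otimes> w \<in> C}"
      using unit_nbhd_square[OF unit_nbhd_left[OF C(1) c(1)]] by metis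
    define C' where "C' = {z \<in> carrier G. inv c \<otimes> z \<in> Z}"
    have C': "openin T C'" "c \<in> C'"
      using Z(1) c openin_mult_left[of Z "inv c"] unfolding C'_def unit_nbhd_def by auto
    have inC: "y \<in> C" if y: "y \<in> carrier G" and z: "z \<in> Z" "inv c \<otimes> (y \<otimes> inv z) \<in> Z" for y z
    proof -
      have "z \<in> carrier G"
        using z Z by simp
      then have "c \<otimes> ((inv c \<otimes> (y \<otimes> inv z)) \<otimes> z) = y"
        using y c by (simp add: m_assoc)
      then show ?thesis
        using Z(2)[OF z(2,1)] by simp
    qed
    have "C' \<subseteq> C"
      using inC[of _ \<one>] Z(1) unfolding C'_def unit_nbhd_def by auto
    moreover have "y \<in> C" if y: "y \<in> carrier G"
      and N: "\<forall>N\<in>(\<lambda>N. set_inv N) ` Collect unit_nbhd. (y <# N) \<inter> C' \<noteq> {}" for y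
    proof -
      have "(y <# set_inv Z) \<inter> C' \<noteq> {}"
        using N Z(1) by simp
      then obtain z where "z \<in> Z" "y \<otimes> inv z \<in> C'"
        unfolding meet by blast
      then show ?thesis
        using inC y unfolding C'_def by simp
    qed
    ultimately show "\<exists>C'. openin T C' \<and> C' \<noteq> {} \<and> C' \<subseteq> C \<and>
      (\<forall>y\<in>carrier G. (\<forall>N\<in>(\<lambda>N. set_inv N) ` Collect unit_nbhd. (y <# N) \<inter> C' \<noteq> {}) \<longrightarrow> y \<in> C)"
      using C' by (intro exI[of _ C']) blast
  qed (use W in simp)
  then obtain C c where C: "openin T C" "c \<in> C"
    "\<And>C'. openin T C' \<Longrightarrow> C' \<noteq> {} \<Longrightarrow> C' \<subseteq> C \<Longrightarrow> C \<subseteq> T closure_of (C' <#> set_inv W)"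
    by (metis ex_in_conv)
  have c: "c \<in> carrier G"
    using C openin_carrier by blast
  have inC: "inv v \<in> T closure_of U" if v: "v \<in> carrier G" "c \<otimes> v \<in> C" for v
  proof -
    have "\<exists>n\<in>N. inv v \<otimes> n \<in> U" if N: "unit_nbhd N" for N
    proof -
      \<comment> \<open>The roles are swapped compared with the quasiregular proof: the set shrinks
        around \<open>c\<close>, and \<open>c \<otimes> v\<close> is the point of the closure.
        Writing \<open>c \<otimes> v \<otimes> w = z \<otimes> inv a\<close> makes
        \<open>inv c \<otimes> z\<close> the witness in \<open>N\<close>.\<close>
      let ?C = "{z \<in> carrier G. inv c \<otimes> z \<in> N} \<inter> C"
      have "openin T ?C" "c \<in> ?C"
        using c N C(1,2) openin_mult_left[of N "inv c"] unfolding unit_nbhd_def by auto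
      then have "c \<otimes> v \<in> T closure_of (?C <#> set_inv W)"
        using C(3) v by blast
      then obtain w where w: "w \<in> W" "c \<otimes> v \<otimes> w \<in> ?C <#> set_inv W"
        using W in_closure_left by blast
      then obtain z a where z: "z \<in> carrier G" "inv c \<otimes> z \<in> N" "a \<in> W" "c \<otimes> v \<otimes> w = z \<otimes> inv a"
        unfolding set_mult_def SET_INV_def by blast
      have ac: "a \<in> carrier G" "w \<in> carrier G"
        using W w z by auto
      have "inv v \<otimes> (inv c \<otimes> z) = inv v \<otimes> (inv c \<otimes> (c \<otimes> v \<otimes> w \<otimes> a))"
        using z ac by (simp add: m_assoc)
      also have "\<dots> = w \<otimes> a"
        using c v ac by (simp add: m_assoc)
      also have "\<dots> \<in> U"
        using W w z by blast
      finally show ?thesis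
        using z by blast
    qed
    then show ?thesis
      using v(1) unfolding in_closure_left by simp
  qed
  show ?thesis
    by (rule that[OF unit_nbhd_left[OF C(1,2)]]) (simp add: inC)
qed

section \<open>Continuity of inversion, and saturation from quasiregularity\<close>

text \<open>Continuity at the identity spreads by translation:
  \<open>inv z = inv (inv x \<otimes> z) \<otimes> inv x\<close>.\<close>

lemma topological_groupI:
  assumes "\<And>U. unit_nbhd U \<Longrightarrow> \<exists>V. unit_nbhd V \<and> (\<forall>v\<in>V. inv v \<in> U)"
  shows "topological_group G T"
proof -
  have "openin T {x \<in> topspace T. inv x \<in> U}" if U: "openin T U" for U
  proof (subst openin_subopen, intro ballI)
    fix x assume "x \<in> {x \<in> topspace T. inv x \<in> U}"
    then have x: "x \<in> carrier G" "inv x \<in> U"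
      using topspace_eq_carrier by auto
    obtain V where V: "unit_nbhd V" "\<forall>v\<in>V. inv v \<in> {w \<in> carrier G. w \<otimes> inv x \<in> U}"
      using assms[OF unit_nbhd_right[OF U x(2)]] by metis
    let ?N = "{z \<in> carrier G. inv x \<otimes> z \<in> V}"
    have "openin T ?N" "x \<in> ?N"
      using V(1) x(1) openin_mult_left[of V "inv x"] unfolding unit_nbhd_def by auto
    moreover have "?N \<subseteq> {x \<in> topspace T. inv x \<in> U}"
    proof
      fix z assume z: "z \<in> ?N"
      then have "inv (inv x \<otimes> z) \<otimes> inv x \<in> U"
        using V(2) by blast
      then show "z \<in> {x \<in> topspace T. inv x \<in> U}"
        using z x(1) topspace_eq_carrier by (simp add: inv_mult_group m_assoc)
    qed
    ultimately show "\<exists>N. openin T N \<and> x \<in> N \<and> N \<subseteq> {x \<in> topspace T. inv x \<in> U}"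
      by (intro exI[of _ ?N] conjI)
  qed
  then have "continuous_map T T (\<lambda>x. inv x)"
    using topspace_eq_carrier by (simp add: continuous_map)
      (metis image_subsetI inv_closed)
  then show ?thesis
    by (simp add: topological_group_def topological_group_axioms_def paratopological_group_axioms)
qed

lemma saturated_imp_topological_group:
  assumes fc: "feebly_compact_space T" and sat: "saturated G T"
  shows "topological_group G T"
proof (rule topological_groupI)
  fix U assume "unit_nbhd U"
  then obtain W where W: "unit_nbhd W" "\<forall>a\<in>W. \<forall>b\<in>W. a \<otimes> b \<in> U"
    using unit_nbhd_square by metis
  obtain N where N: "unit_nbhd N" "\<And>v. v \<in> N \<Longrightarrow> inv v \<in> T closure_of W"
    using saturated_inv_in_closure[OF fc sat W(1)] by metis
  \<comment> \<open>Inverses in \<open>N\<close> will place \<open>V\<close> in the closure of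
    \<open>W\<close>; inverses in \<open>W\<close> supply the first factor of the final
    product.\<close>
  have NW: "openin T (N \<inter> W)" "N \<inter> W \<noteq> {}"
    using unit_nbhd_Int[OF N(1) W(1)] unfolding unit_nbhd_def by auto
  obtain V where V: "openin T V" "V \<noteq> {}" "\<forall>v\<in>V. inv v \<in> N \<inter> W"
    using saturatedD[OF sat NW] by metis
  then obtain p where p: "p \<in> V" "p \<in> carrier G"
    using openin_carrier by blast
  then have "inv (inv p) \<in> T closure_of W"
    using V(3) N(2) by blast
  then obtain v where v: "v \<in> W" "v \<in> V"
    using closure_of_meets[of p W V] V(1) p by auto
  have "inv w \<in> U" if w: "w \<in> carrier G" "v \<otimes> w \<in> V" for w
  proof -
    have vc: "v \<in> carrier G"
      using v W(1) by simp
    \<comment> \<open>This product of two elements of \<open>W\<close> equals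
      \<open>inv w\<close>.\<close>
    have "inv (v \<otimes> w) \<otimes> v \<in> U"
      using V(3) W(2) v w by blast
    then show ?thesis
      using w vc by (simp add: inv_mult_group m_assoc)
  qed
  then show "\<exists>V. unit_nbhd V \<and> (\<forall>v\<in>V. inv v \<in> U)"
    using unit_nbhd_left[OF V(1) v(2)] by (metis (no_types, lifting) mem_Collect_eq)
qed

text \<open>Quasiregularity absorbs the closure: left translation by a point \<open>u\<close> of
  \<open>U\<close> carries \<open>inv v\<close> into the closure of \<open>U\<close>, hence into
  \<open>W\<close>. So \<open>V\<close> and \<open>u\<close> meet the criterion
  \<open>saturatedI\<close>.\<close>

lemma quasiregular_imp_saturated:
  assumes fc: "feebly_compact_space T" and qr: "quasiregular_space T"
  shows "saturated G T"
proof (rule saturatedI)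
  fix W assume W: "unit_nbhd W"
  then obtain U where U: "openin T U" "U \<noteq> {}" "T closure_of U \<subseteq> W"
    using qr unfolding quasiregular_space_def unit_nbhd_def by (metis empty_iff)
  then obtain u where u: "u \<in> U" "u \<in> carrier G"
    using openin_carrier by blast
  obtain V where V: "unit_nbhd V" "\<And>v. v \<in> V \<Longrightarrow> inv v \<in> T closure_of {w \<in> carrier G. u \<otimes> w \<in> U}"
    using quasiregular_inv_in_closure[OF fc qr unit_nbhd_left[OF U(1) u(1)]] by metis
  have "u \<otimes> inv v \<in> W" if v: "v \<in> V" for v
  proof -
    have vc: "v \<in> carrier G"
      using v V(1) by simp
    have "\<exists>n\<in>N. u \<otimes> inv v \<otimes> n \<in> U" if N: "unit_nbhd N" for N
    proof -
      obtain n where "n \<in> N" "inv v \<otimes> n \<in> {w \<in> carrier G. u \<otimes> w \<in> U}"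
        using V(2)[OF v] N unfolding in_closure_left by metis
      then show ?thesis
        using u vc N by (intro bexI[of _ n]) (auto simp: m_assoc)
    qed
    then have "u \<otimes> inv v \<in> T closure_of U"
      using u vc unfolding in_closure_left by simp
    then show ?thesis
      using U(3) by blast
  qed
  then show "\<exists>P g. openin T P \<and> P \<noteq> {} \<and> g \<in> carrier G \<and> (\<forall>x\<in>P. g \<otimes> inv x \<in> W)"
    using V(1) u(2) unfolding unit_nbhd_def by (metis empty_iff)
qed

section \<open>Saturation from category arguments\<close>

text \<open>The set in question is the inverse of \<open>f <# W\<close>. A point \<open>x\<close> of
  its closure enters it after left multiplication by some \<open>w\<close> in \<open>W\<close>;
  multiplying the resulting inverse by \<open>w\<close> on the right puts
  \<open>inv f \<otimes> inv x\<close> in \<open>W <#> W\<close>.\<close>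

lemma saturated_if_somewhere_dense:
  assumes "\<And>W. unit_nbhd W \<Longrightarrow>
    \<exists>f\<in>carrier G. T interior_of (T closure_of {x \<in> carrier G. inv f \<otimes> inv x \<in> W}) \<noteq> {}"
  shows "saturated G T"
proof (rule saturatedI)
  fix U assume "unit_nbhd U"
  then obtain W where W: "unit_nbhd W" "\<forall>a\<in>W. \<forall>b\<in>W. a \<otimes> b \<in> U"
    using unit_nbhd_square by metis
  obtain f where f: "f \<in> carrier G"
    "T interior_of (T closure_of {x \<in> carrier G. inv f \<otimes> inv x \<in> W}) \<noteq> {}"
    using assms[OF W(1)] by metis
  define P where "P = T interior_of (T closure_of {x \<in> carrier G. inv f \<otimes> inv x \<in> W})"
  have "inv f \<otimes> inv x \<in> U" if "x \<in> P" for x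
  proof -
    have x: "x \<in> T closure_of {x \<in> carrier G. inv f \<otimes> inv x \<in> W}"
      using that interior_of_subset unfolding P_def by fast
    then obtain w where w: "w \<in> W" "inv f \<otimes> inv (w \<otimes> x) \<in> W"
      using in_closure_right[OF x W(1)] by blast
    have c: "x \<in> carrier G" "w \<in> carrier G"
      using x w(1) W(1) in_closure_left by auto
    have "inv f \<otimes> inv (w \<otimes> x) \<otimes> w \<in> U"
      using W(2) w by blast
    then show ?thesis
      using c f(1) by (simp add: inv_mult_group m_assoc)
  qed
  moreover have "openin T P" "P \<noteq> {}"
    using f(2) unfolding P_def by simp_all
  ultimately show "\<exists>P g. openin T P \<and> P \<noteq> {} \<and> g \<in> carrier G \<and> (\<forall>x\<in>P. g \<otimes> inv x \<in> U)"
    using f(1) inv_closed by metis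
qed

lemma unit_nbhd_neighbourhood_in: "unit_nbhd U \<Longrightarrow> neighbourhood_in T \<one> U"
  unfolding unit_nbhd_def neighbourhood_in_def using openin_subset by blast

lemma topspace_nonempty: "topspace T \<noteq> {}"
  using topspace_eq_carrier one_closed by auto

lemma set_mult_eq_carrier_cover:
  assumes "F <#> W = carrier G" "F \<subseteq> carrier G" "W \<subseteq> carrier G"
  shows "topspace T \<subseteq> (\<Union>f\<in>F. {x \<in> carrier G. inv f \<otimes> inv x \<in> W})"
proof
  fix x assume "x \<in> topspace T"
  then have x: "x \<in> carrier G"
    using topspace_eq_carrier by simp
  then have "inv x \<in> F <#> W"
    using assms(1) by simp
  then obtain f w where fw: "f \<in> F" "w \<in> W" "inv x = f \<otimes> w"
    unfolding set_mult_def by blast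
  then have "inv f \<otimes> inv x = w"
    using assms(2,3) by (metis inv_mult_cancel_left(2) subsetD)
  then show "x \<in> (\<Union>f\<in>F. {x \<in> carrier G. inv f \<otimes> inv x \<in> W})"
    using x fw by (metis (no_types, lifting) UN_iff mem_Collect_eq)
qed

lemma left_omega_precompact_baire_imp_saturated:
  assumes lp: "left_omega_precompact G T" and baire: "baire_space T"
  shows "saturated G T"
proof (rule saturated_if_somewhere_dense)
  fix W assume W: "unit_nbhd W"
  then obtain F where F: "F \<subseteq> carrier G" "countable F" "F <#> W = carrier G"
    using lp unit_nbhd_neighbourhood_in unfolding left_omega_precompact_def by metis
  have "W \<subseteq> carrier G"
    using W by auto
  from baire_somewhere_dense[OF baire F(2) topspace_nonempty set_mult_eq_carrier_cover[OF F(3,1) this]]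
  show "\<exists>f\<in>carrier G. T interior_of (T closure_of {x \<in> carrier G. inv f \<otimes> inv x \<in> W}) \<noteq> {}"
    using F(1) by blast
qed

lemma precompact_imp_saturated:
  assumes pc: "precompact G T"
  shows "saturated G T"
proof (rule saturated_if_somewhere_dense)
  fix W assume W: "unit_nbhd W"
  then obtain F where F: "F \<subseteq> carrier G" "finite F" "F <#> W = carrier G"
    using pc unit_nbhd_neighbourhood_in unfolding precompact_def by metis
  have "W \<subseteq> carrier G"
    using W by auto
  from finite_Union_somewhere_dense[OF F(2) topspace_nonempty set_mult_eq_carrier_cover[OF F(3,1) this]]
  show "\<exists>f\<in>carrier G. T interior_of (T closure_of {x \<in> carrier G. inv f \<otimes> inv x \<in> W}) \<noteq> {}"
    using F(1) by blast
qed

text \<open>By Baire, \<open>x [^] n\<close> has its inverse near \<open>\<one>\<close> for all \<open>x\<close> in an open set and a fixed \<open>n\<close>; then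
  use \<open>inv x = x [^] (n - 1) \<otimes> inv (x [^] n)\<close>.\<close>

lemma topologically_periodic_baire_imp_saturated:
  assumes per: "topologically_periodic G T" and baire: "baire_space T"
  shows "saturated G T"
proof (rule saturatedI)
  fix U assume "unit_nbhd U"
  then obtain W where W: "unit_nbhd W" "\<forall>a\<in>W. \<forall>b\<in>W. a \<otimes> b \<in> U"
    using unit_nbhd_square by metis
  obtain V where V: "unit_nbhd V" "\<forall>a\<in>V. \<forall>b\<in>V. a \<otimes> b \<in> W"
    using unit_nbhd_square[OF W(1)] by metis
  \<comment> \<open>The shift makes \<open>Suc n\<close> run over the exponents at least 1.
    Periodicity is applied to \<open>inv x\<close>, whose powers are the inverses of the powers of
    \<open>x\<close>.\<close>
  define A where "A n = {x \<in> carrier G. inv (x [^] Suc n) \<in> V}" for n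
  have "topspace T \<subseteq> (\<Union>n\<in>UNIV. A n)"
  proof
    fix x assume "x \<in> topspace T"
    then have x: "x \<in> carrier G"
      using topspace_eq_carrier by simp
    then obtain n :: nat where n: "n \<ge> 1" "inv x [^] n \<in> V"
      using per unit_nbhd_neighbourhood_in[OF V(1)] inv_closed unfolding topologically_periodic_def by metis
    then obtain m where "n = Suc m"
      by (cases n) auto
    then have "x \<in> A m"
      using n x unfolding A_def by (simp only: nat_pow_inv mem_Collect_eq)
    then show "x \<in> (\<Union>n\<in>UNIV. A n)"
      by blast
  qed
  then obtain n where n: "T interior_of (T closure_of A n) \<noteq> {}"
    using baire_somewhere_dense[OF baire _ topspace_nonempty, of UNIV A] by auto
  define P where "P = T interior_of (T closure_of A n)"
  have P: "openin T P" "P \<subseteq> carrier G"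
    using openin_carrier[of P] unfolding P_def by simp_all
  have inW: "inv (x [^] Suc n) \<in> W" if "x \<in> P" for x
  proof -
    have x: "x \<in> carrier G" "x \<in> T closure_of A n"
      using that P interior_of_subset[of T "T closure_of A n"] unfolding P_def by auto
    define q where "q = x [^] Suc n"
    have q: "q \<in> carrier G"
      using x(1) unfolding q_def by simp
    \<comment> \<open>Powers are continuous, so some \<open>z\<close> in \<open>A n\<close> has a
      power \<open>p\<close> with \<open>p \<otimes> inv q\<close> in \<open>V\<close>; then
      \<open>inv q = inv p \<otimes> (p \<otimes> inv q)\<close> is a product of two elements of
      \<open>V\<close>.\<close>
    define N where "N = {z \<in> carrier G. z \<otimes> inv q \<in> V}"
    have N: "openin T N" "q \<in> N"
      using V(1) q openin_mult_right[of V "inv q"] unfolding N_def unit_nbhd_def by auto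
    have "openin T {z \<in> topspace T. z [^] Suc n \<in> N}"
      by (rule openin_continuous_map_preimage[OF continuous_map_nat_pow N(1)])
    then obtain z where z: "z \<in> A n" "z [^] Suc n \<in> N"
      using closure_of_meets[OF x(2), of "{z \<in> topspace T. z [^] Suc n \<in> N}"] N(2) x(1) topspace_eq_carrier
      unfolding q_def by auto
    define p where "p = z [^] Suc n"
    have p: "p \<in> carrier G" "inv p \<in> V" "p \<otimes> inv q \<in> V"
      using z unfolding p_def N_def A_def by auto
    then have "inv p \<otimes> (p \<otimes> inv q) \<in> W"
      using V(2) by blast
    then show ?thesis
      using p q unfolding q_def by simp
  qed
  obtain c where c: "c \<in> P" "c \<in> carrier G"
    using n P unfolding P_def by blast
  define g where "g = inv (c [^] n)"
  have g: "g \<in> carrier G"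
    using c unfolding g_def by simp
  \<comment> \<open>Near \<open>c\<close> the power \<open>x [^] n\<close> is close to
    \<open>c [^] n\<close>, so \<open>g\<close> brings it into \<open>W\<close>.\<close>
  define Q where "Q = P \<inter> {x \<in> topspace T. x [^] n \<in> {z \<in> carrier G. g \<otimes> z \<in> W}}"
  have "openin T Q"
    unfolding Q_def
  proof (intro openin_Int P(1) openin_continuous_map_preimage[OF continuous_map_nat_pow])
    show "openin T {z \<in> carrier G. g \<otimes> z \<in> W}"
      using W(1) g openin_mult_left unfolding unit_nbhd_def by simp
  qed
  moreover have "c \<in> Q"
    using c W(1) topspace_eq_carrier unfolding Q_def g_def unit_nbhd_def by simp
  moreover have "g \<otimes> inv x \<in> U" if "x \<in> Q" for x
  proof -
    have x: "x \<in> carrier G" "g \<otimes> x [^] n \<in> W" "inv (x [^] Suc n) \<in> W"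
      using that inW P(2) unfolding Q_def by auto
    \<comment> \<open>With \<open>x\<close> on the left, the inverse of the power starts with
      \<open>inv (x [^] n)\<close>, which cancels against \<open>x [^] n\<close>.\<close>
    have "x [^] Suc n = x \<otimes> x [^] n"
      using x(1) by (rule nat_pow_Suc2)
    then have "g \<otimes> inv x = (g \<otimes> x [^] n) \<otimes> inv (x [^] Suc n)"
      using x(1) g by (simp add: inv_mult_group m_assoc del: nat_pow_Suc)
    then show ?thesis
      using W(2) x(2,3) by simp
  qed
  ultimately show "\<exists>P g. openin T P \<and> P \<noteq> {} \<and> g \<in> carrier G \<and> (\<forall>x\<in>P. g \<otimes> inv x \<in> U)"
    using g by (metis empty_iff)
qed

end

section \<open>Feebly compact topological groups\<close>

context topological_group
begin

lemma unit_nbhd_symmetric_square: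
  assumes "unit_nbhd U"
  shows "\<exists>V. unit_nbhd V \<and> (\<forall>a\<in>V. inv a \<in> V) \<and> (\<forall>a\<in>V. \<forall>b\<in>V. a \<otimes> b \<in> U)"
proof -
  obtain W where W: "unit_nbhd W" "\<forall>a\<in>W. \<forall>b\<in>W. a \<otimes> b \<in> U"
    using unit_nbhd_square[OF assms] by metis
  define V where "V = W \<inter> {x \<in> topspace T. inv x \<in> W}"
  have "openin T V"
    unfolding V_def using W(1) openin_continuous_map_preimage[OF continuous_inv]
    unfolding unit_nbhd_def by (intro openin_Int) simp_all
  then have "unit_nbhd V"
    using W(1) topspace_eq_carrier unfolding V_def unit_nbhd_def by simp
  moreover have "\<forall>a\<in>V. inv a \<in> V"
    using topspace_eq_carrier unfolding V_def by simp
  moreover have "\<forall>a\<in>V. \<forall>b\<in>V. a \<otimes> b \<in> U"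
    using W(2) unfolding V_def by simp
  ultimately show ?thesis
    by (intro exI[of _ V]) simp
qed

text \<open>For symmetric \<open>V\<close>, the closure of \<open>u <# V\<close> lies in the
  translate by \<open>u\<close> of \<open>V <#> V\<close>.\<close>

lemma imp_quasiregular: "quasiregular_space T"
  unfolding quasiregular_space_def
proof (intro allI impI)
  fix U assume U: "openin T U \<and> U \<noteq> {}"
  then obtain u where u: "u \<in> U" "u \<in> carrier G"
    using openin_carrier by blast
  obtain V where V: "unit_nbhd V" "\<forall>a\<in>V. inv a \<in> V" "\<forall>a\<in>V. \<forall>b\<in>V. a \<otimes> b \<in> {w \<in> carrier G. u \<otimes> w \<in> U}"
    using unit_nbhd_symmetric_square[OF unit_nbhd_left[of U u]] U u by metis
  define N where "N = {z \<in> carrier G. inv u \<otimes> z \<in> V}"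
  have "openin T N" "u \<in> N"
    using V(1) u openin_mult_left[of V "inv u"] unfolding N_def unit_nbhd_def by auto
  moreover have "T closure_of N \<subseteq> U"
  proof
    fix x assume "x \<in> T closure_of N"
    then obtain v where v: "x \<in> carrier G" "v \<in> V" "inv u \<otimes> (x \<otimes> v) \<in> V"
      using V(1) unfolding in_closure_left N_def by blast
    then have vc: "v \<in> carrier G"
      using V(1) by simp
    have "(inv u \<otimes> (x \<otimes> v)) \<otimes> inv v \<in> {w \<in> carrier G. u \<otimes> w \<in> U}"
      using V(2,3) v by blast
    then show "x \<in> U"
      using u v(1) vc by (simp add: m_assoc)
  qed
  ultimately show "\<exists>V. openin T V \<and> V \<noteq> {} \<and> T closure_of V \<subseteq> U"
    by blast
qed

text \<open>Otherwise choose points \<open>f n\<close> outside the translates of \<open>U\<close> by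
  all earlier ones. The small neighbourhoods \<open>B (f n)\<close> accumulate at some
  \<open>y\<close>, so \<open>B y\<close> meets two of them, which forces their centres closer than
  \<open>U\<close> permits.\<close>

lemma feebly_compact_imp_finite_cover:
  assumes fc: "feebly_compact_space T" and U: "unit_nbhd U"
  shows "\<exists>F. F \<subseteq> carrier G \<and> finite F \<and> F <#> U = carrier G"
proof (rule ccontr)
  assume no: "\<not> ?thesis"
  have Uc: "U \<subseteq> carrier G"
    using U by auto
  have ex: "\<exists>x\<in>carrier G. x \<notin> F <#> U" if "F \<subseteq> carrier G" "finite F" for F
  proof (rule ccontr)
    assume "\<not> ?thesis"
    then have "F <#> U = carrier G"
      using set_mult_closed[OF that(1) Uc] by blast
    then show False
      using no that by simp
  qed
  have "\<exists>f :: nat \<Rightarrow> 'a. \<forall>n. f n \<in> carrier G \<and> f n \<notin> f ` {..<n} <#> U"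
  \<comment> \<open>Each \<open>f n\<close> has to avoid the translates of all earlier values and
    not just of the last one, hence recursion along \<open>less_than\<close>.\<close>
  proof (rule dependent_wf_choice[of less_than
        "\<lambda>f n r. r \<in> carrier G \<and> r \<notin> f ` {..<n} <#> U"])
    fix f g :: "nat \<Rightarrow> 'a" and n :: nat and r
    assume "\<And>z. (z, n) \<in> less_than \<Longrightarrow> f z = g z"
    then have "f ` {..<n} = g ` {..<n}"
      by (intro image_cong) auto
    then show "(r \<in> carrier G \<and> r \<notin> f ` {..<n} <#> U) = (r \<in> carrier G \<and> r \<notin> g ` {..<n} <#> U)"
      by simp
  next
    fix n :: nat and f
    assume "\<And>y. (y, n) \<in> less_than \<Longrightarrow> f y \<in> carrier G \<and> f y \<notin> f ` {..<y} <#> U"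
    then show "\<exists>r. r \<in> carrier G \<and> r \<notin> f ` {..<n} <#> U"
      using ex[of "f ` {..<n}"] by (simp add: image_subset_iff Bex_def)
  qed simp
  then obtain f :: "nat \<Rightarrow> 'a" where f: "\<And>n. f n \<in> carrier G" "\<And>n. f n \<notin> f ` {..<n} <#> U"
    by metis
  have sep: "inv (f i) \<otimes> f j \<notin> U" if "i < j" for i j
  proof
    assume "inv (f i) \<otimes> f j \<in> U"
    moreover have "f i \<in> f ` {..<j}"
      using that by simp
    ultimately have "f i \<otimes> (inv (f i) \<otimes> f j) \<in> f ` {..<j} <#> U"
      unfolding set_mult_def by blast
    then have "f j \<in> f ` {..<j} <#> U"
      using f(1) by simp
    then show False
      using f(2) by simp
  qed
  obtain W where W: "unit_nbhd W" "\<forall>a\<in>W. \<forall>b\<in>W. a \<otimes> b \<in> U"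
    using unit_nbhd_square[OF U] by metis
  obtain V where V: "unit_nbhd V" "\<forall>a\<in>V. inv a \<in> V" "\<forall>a\<in>V. \<forall>b\<in>V. a \<otimes> b \<in> W"
    using unit_nbhd_symmetric_square[OF W(1)] by metis
  define B where "B x = {z \<in> carrier G. inv x \<otimes> z \<in> V}" for x
  have B: "openin T (B x) \<and> x \<in> B x" if "x \<in> carrier G" for x
    using that V(1) openin_mult_left[of V "inv x"] unfolding B_def unit_nbhd_def by simp
  \<comment> \<open>Through a common point \<open>z\<close>, \<open>inv x \<otimes> y\<close> is
    \<open>inv x \<otimes> z\<close> times the inverse of \<open>inv y \<otimes> z\<close>, both in
    the symmetric \<open>V\<close>.\<close>
  have near: "inv x \<otimes> y \<in> W" if xy: "B x \<inter> B y \<noteq> {}" "x \<in> carrier G" "y \<in> carrier G" for x y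
  proof -
    obtain z where z: "z \<in> carrier G" "inv x \<otimes> z \<in> V" "inv y \<otimes> z \<in> V"
      using xy(1) unfolding B_def by blast
    then have "(inv x \<otimes> z) \<otimes> inv (inv y \<otimes> z) \<in> W"
      using V(2,3) by simp
    then show ?thesis
      using z xy(2,3) by (simp add: inv_mult_group m_assoc)
  qed
  have "openin T (B (f n)) \<and> B (f n) \<noteq> {}" for n
    using B[OF f(1)[of n]] by auto
  from feebly_compact_accumulation[of T "\<lambda>n. B (f n)", OF fc this]
  obtain y where y: "y \<in> topspace T" "\<forall>N. openin T N \<and> y \<in> N \<longrightarrow> (\<exists>\<^sub>\<infinity>n. N \<inter> B (f n) \<noteq> {})"
    by (rule bexE)
  have yc: "y \<in> carrier G"
    using y(1) topspace_eq_carrier by simp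
  have inf: "\<exists>\<^sub>\<infinity>n. B y \<inter> B (f n) \<noteq> {}"
    using y(2) B[OF yc] by simp
  from INFM_EX[OF this] obtain i where i: "B y \<inter> B (f i) \<noteq> {}"
    by metis
  obtain j where j: "j > i" "B y \<inter> B (f j) \<noteq> {}"
    using inf unfolding INFM_nat by metis
  have "B (f i) \<inter> B y \<noteq> {}"
    using i by blast
  then have "inv (f i) \<otimes> y \<in> W"
    by (rule near[OF _ f(1) yc])
  moreover have "inv y \<otimes> f j \<in> W"
    by (rule near[OF j(2) yc f(1)])
  ultimately have "(inv (f i) \<otimes> y) \<otimes> (inv y \<otimes> f j) \<in> U"
    using W(2) by blast
  then show False
    using sep[OF j(1)] f(1) yc by (simp add: m_assoc)
qed

lemma feebly_compact_imp_precompact: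
  assumes fc: "feebly_compact_space T"
  shows "precompact G T"
  unfolding precompact_def
proof (intro allI impI)
  fix U assume "neighbourhood_in T \<one> U"
  then obtain V where V: "unit_nbhd V" "V \<subseteq> U" "U \<subseteq> carrier G"
    using topspace_eq_carrier unfolding neighbourhood_in_def unit_nbhd_def by metis
  then obtain F where F: "F \<subseteq> carrier G" "finite F" "F <#> V = carrier G"
    using feebly_compact_imp_finite_cover[OF fc] by metis
  have "F <#> V \<subseteq> F <#> U"
    using V(2) by (simp add: mono_set_mult)
  then show "\<exists>F. F \<subseteq> carrier G \<and> finite F \<and> F <#> U = carrier G"
    using F set_mult_closed[OF F(1) V(3)] by (intro exI[of _ F]) simp
qed

text \<open>Pigeonhole on powers: finitely many translates of \<open>V\<close> cover the group, so
  \<open>x [^] i\<close> and \<open>x [^] j\<close> with \<open>i < j\<close> share one, and their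
  quotient \<open>x [^] (j - i)\<close> lies in \<open>V <#> V\<close>.\<close>

lemma feebly_compact_imp_topologically_periodic:
  assumes fc: "feebly_compact_space T"
  shows "topologically_periodic G T"
  unfolding topologically_periodic_def
proof (intro ballI allI impI)
  fix x U assume x: "x \<in> carrier G" and "neighbourhood_in T \<one> U"
  then obtain U' where U': "unit_nbhd U'" "U' \<subseteq> U"
    unfolding neighbourhood_in_def unit_nbhd_def by metis
  obtain V where V: "unit_nbhd V" "\<forall>a\<in>V. inv a \<in> V" "\<forall>a\<in>V. \<forall>b\<in>V. a \<otimes> b \<in> U'"
    using unit_nbhd_symmetric_square[OF U'(1)] by metis
  obtain F where F: "F \<subseteq> carrier G" "finite F" "F <#> V = carrier G"
    using feebly_compact_imp_finite_cover[OF fc V(1)] by metis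
  have "\<exists>f. f \<in> F \<and> inv f \<otimes> x [^] n \<in> V" for n :: nat
  proof -
    have "x [^] n \<in> F <#> V"
      using F(3) x by simp
    then obtain f v where fv: "f \<in> F" "v \<in> V" "x [^] n = f \<otimes> v"
      unfolding set_mult_def by blast
    moreover have "f \<in> carrier G" "v \<in> carrier G"
      using fv F(1) V(1) by auto
    ultimately show ?thesis
      by (intro exI[of _ f]) simp
  qed
  then obtain f where f: "\<And>n::nat. f n \<in> F" "\<And>n. inv (f n) \<otimes> x [^] n \<in> V"
    by metis
  have "\<not> inj f"
    using f(1) F(2) finite_subset[of "range f" F] finite_imageD[of f UNIV] by auto
  then obtain i j where ij: "i < j" "f i = f j"
    unfolding inj_def by (metis linorder_neqE_nat)
  have fc: "f j \<in> carrier G"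
    using f(1) F(1) by blast
  have "inv (inv (f j) \<otimes> x [^] i) \<otimes> (inv (f j) \<otimes> x [^] j) \<in> U'"
    using V(2,3) f(2)[of i] f(2)[of j] ij(2) by simp
  moreover have "x [^] j = x [^] i \<otimes> x [^] (j - i)"
    using x ij(1) by (simp add: nat_pow_mult)
  ultimately have "x [^] (j - i) \<in> U'"
    using x fc by (simp add: inv_mult_group m_assoc)
  then show "\<exists>n::nat. n \<ge> 1 \<and> x [^] n \<in> U"
    using U'(2) ij(1) by (intro exI[of _ "j - i"]) auto
qed

end

section \<open>The equivalences\<close>

lemma precompact_imp_left_omega_precompact:
  "precompact G T \<Longrightarrow> left_omega_precompact G T"
  unfolding precompact_def left_omega_precompact_def using countable_finite by metis

theorem proposition3p15:
  fixes G :: "('a, 'b) monoid_scheme" and T :: "'a topology"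
  assumes "paratopological_group G T"
    and "feebly_compact_space T"
  shows "(quasiregular_space T \<longleftrightarrow> saturated G T) \<and>
         (saturated G T \<longleftrightarrow> topologically_periodic G T \<and> baire_space T) \<and>
         (topologically_periodic G T \<and> baire_space T \<longleftrightarrow>
            left_omega_precompact G T \<and> baire_space T) \<and>
         (left_omega_precompact G T \<and> baire_space T \<longleftrightarrow> precompact G T) \<and>
         (precompact G T \<longleftrightarrow> topological_group G T)"
proof -
  interpret paratopological_group G T
    by fact
  have group: "topological_group G T" if "saturated G T"
    using saturated_imp_topological_group[OF assms(2) that] .
  \<comment> \<open>Quasiregularity acts twice: it yields the Baire property, and it leads back to
    saturation through \<open>quasiregular_imp_saturated\<close>.\<close>
  have from_group: "quasiregular_space T \<and> topologically_periodic G T \<and> baire_space T \<and> precompact G T"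
    if "topological_group G T"
    using topological_group.imp_quasiregular[OF that]
      topological_group.feebly_compact_imp_topologically_periodic[OF that assms(2)]
      topological_group.feebly_compact_imp_precompact[OF that assms(2)]
      feebly_compact_quasiregular_imp_baire[OF assms(2)] by simp
  show ?thesis
    using group from_group quasiregular_imp_saturated[OF assms(2)]
      topologically_periodic_baire_imp_saturated left_omega_precompact_baire_imp_saturated
      precompact_imp_saturated precompact_imp_left_omega_precompact[of G T]
    by argo
qed

end
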